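(* Let $A \in C_{n,n}(\mathbf{P})$ and $B\in X_{n,m}(\mathbf{P})$ with associated bounded linear operators $\mathcal{A} \in L(X_n(\mathbf{P}))$, $(\mathcal{A}f)(\theta)=A(\theta)f(\theta)$, and $\mathcal{B}\in L(\mathbb{C}^m, X_n(\mathbf{P}))$, $(\mathcal{B}v)(\theta)=B(\theta)v$. Then for every bounded linear operator $\mathcal{F}\in L(X_n(\mathbf{P}),\mathbb{C}^m)$ the pair $(\mathcal{A},\mathcal{B})$ is ensemble reachable (with respect to $X_n(\mathbf{P})$) if and only if $(\mathcal{A}+ \mathcal{B}\mathcal{F},\mathcal{B})$ is ensemble reachable (with respect to $X_n(\mathbf{P})$).
   Context: $\mathbf{P}\subset\mathbb{C}$ is a nonempty compact set. $C(\mathbf{P})$ is the space of continuous functions $\mathbf{P}\to\mathbb{C}$ and $C_{n,m}(\mathbf{P})$ the space of $n\times m$ matrices with entries in $C(\mathbf{P})$. $X(\mathbf{P})$ is a separable Banach space of functions $\mathbf{P}\to\mathbb{C}$, $X_{n,m}(\mathbf{P})$ is the space of $n\times m$ matrices with entries in $X(\mathbf{P})$, and $X_n(\mathbf{P})=X_{n,1}(\mathbf{P})$ is the Banach space of $\mathbb{C}^n$-valued functions with norm $\|x\|=\max_{1\le i\le n}\|x_i\|_{X(\mathbf{P})}$. It is assumed that for every $A\in C_{n,n}(\mathbf{P})$ the multiplication operator $(\mathcal{A}f)(\theta)=A(\theta)f(\theta)$ is a well-defined bounded linear operator on $X_n(\mathbf{P})$. For $B\in X_{n,m}(\mathbf{P})$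 the operator $\mathcal{B}:\mathbb{C}^m\to X_n(\mathbf{P})$ above is automatically bounded and linear. Ensemble reachability: for $\mathcal{G}\in L(X_n(\mathbf{P}))$, the pair $(\mathcal{G},\mathcal{B})$ is ensemble reachable with respect to $X_n(\mathbf{P})$ if for every $f\in X_n(\mathbf{P})$ and every $\varepsilon>0$ there exist $T\ge 0$ and an input $u$ (independent of $\theta$) such that $\|\varphi(T)-f\|_{X_n(\mathbf{P})}<\varepsilon$, where $\varphi$ is the solution with zero initial condition. In continuous time, $T\in[0,\infty)$, $u\in L^1([0,T],\mathbb{C}^m)$, the system is $\dot x(t)=\mathcal{G}x(t)+\mathcal{B}u(t)$ and $\varphi(T)=\int_0^T e^{(T-\tau)\mathcal{G}}\mathcal{B}u(\tau)\,d\tau$; in discrete time, $T\in\{0,1,2,\dots\}$, $u(k)\in\mathbb{C}^m$, the system is $x(t+1)=\mathcal{G}x(t)+\mathcal{B}u(t)$ and $\varphi(T)=\sum_{k=0}^{T-1}\mathcal{G}^{T-1-k}\mathcal{B}u(k)$. The result applies in either setting (the same one being used for both pairs). *)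

theory Defs
  imports "HOL-Analysis.Analysis"
begin

text \<open>Needed for Bochner integrals in \<open>'x^'n\<close>.\<close>

instance vec :: ("{metric_space, second_countable_topology}", finite) second_countable_topology
proof
  obtain \<B> :: "'a set set" where \<B>: "countable \<B>" "topological_basis \<B>"
    using ex_countable_basis by blast
  define box where "box b = {x :: 'a^'b. \<forall>i. x $ i \<in> b i}" for b
  define \<C> where "\<C> = box ` (\<Pi>\<^sub>E i\<in>UNIV. \<B>)"
  have "topological_basis \<C>"
  proof (rule topological_basisI)
    fix U assume "U \<in> \<C>"
    then obtain b where b: "b \<in> (\<Pi>\<^sub>E i\<in>UNIV. \<B>)" "U = box b"
      unfolding \<C>_def by (elim imageE) simp
    have "open (b i)" for i
      by (rule topological_basis_open[OF \<B>(2) PiE_mem[OF b(1) UNIV_I]])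
    then show "open U"
      unfolding open_vec_def b(2) box_def by (intro ballI exI[of _ b]) simp
  next
    fix S :: "('a^'b) set" and x assume "open S" "x \<in> S"
    then obtain A where A: "\<And>i. open (A i)" "\<And>i. x $ i \<in> A i"
      "\<And>y. (\<And>i. y $ i \<in> A i) \<Longrightarrow> y \<in> S"
      unfolding open_vec_def by meson
    have "\<exists>b. \<forall>i. b i \<in> \<B> \<and> x $ i \<in> b i \<and> b i \<subseteq> A i"
    proof (rule choice, rule allI)
      fix i
      obtain V where "V \<in> \<B>" "x $ i \<in> V" "V \<subseteq> A i"
        using topological_basisE[OF \<B>(2) A(1,2)] .
      then show "\<exists>V. V \<in> \<B> \<and> x $ i \<in> V \<and> V \<subseteq> A i" by (intro exI conjI)
    qed
    then obtain b where b: "\<forall>i. b i \<in> \<B> \<and> x $ i \<in> b i \<and> b i \<subseteq> A i" ..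
    show "\<exists>V\<in>\<C>. x \<in> V \<and> V \<subseteq> S"
    proof (intro bexI conjI)
      show "box b \<in> \<C>"
        unfolding \<C>_def using b by (intro imageI) (simp add: PiE_iff)
      show "x \<in> box b"
        unfolding box_def using b by simp
      show "box b \<subseteq> S"
        unfolding box_def using b by (intro subsetI A(3)) auto
    qed
  qed
  moreover have "countable \<C>"
    unfolding \<C>_def by (intro countable_image countable_PiE finite \<B>(1))
  ultimately show "\<exists>\<C> :: ('a^'b) set set. countable \<C> \<and> open = generate_topology \<C>"
    using topological_basis_imp_subbasis by (intro exI[of _ \<C>] conjI)
qed

text \<open>
  A separable complex Banach space of functions on \<open>P\<close>. The elements of the space are the
  elements of the type \<open>'x\<close>; its class \<open>banach\<close> supplies the norm and its completeness, and
  \<open>second_countable_topology\<close> is separability. The function on \<open>P\<close> that \<open>x\<close> stands for is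
  \<open>ev x\<close>, of which only the values on \<open>P\<close> are relevant: they determine \<open>x\<close>, and the vector space
  operations are the pointwise ones. The class \<open>banach\<close> knows real scalars only, so complex scalar
  multiplication is a separate parameter \<open>smul\<close>, determined by \<open>ev\<close>.
\<close>

locale banach_function_space =
  fixes P :: "complex set"
    and ev :: "'x::{banach, second_countable_topology} \<Rightarrow> complex \<Rightarrow> complex"
    and smul :: "complex \<Rightarrow> 'x \<Rightarrow> 'x"
  assumes ev_add: "\<theta> \<in> P \<Longrightarrow> ev (x + y) \<theta> = ev x \<theta> + ev y \<theta>"
    and ev_smul: "\<theta> \<in> P \<Longrightarrow> ev (smul c x) \<theta> = c * ev x \<theta>"
    and ev_inject: "(\<And>\<theta>. \<theta> \<in> P \<Longrightarrow> ev x \<theta> = ev y \<theta>) \<Longrightarrow> x = y"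
    and smul_of_real: "smul (complex_of_real r) x = r *\<^sub>R x"
    and norm_smul: "norm (smul c x) = cmod c * norm x"

definition vec_ev :: "('x \<Rightarrow> complex \<Rightarrow> complex) \<Rightarrow> 'x^'n \<Rightarrow> complex \<Rightarrow> complex^'n"
  where "vec_ev ev x \<theta> = (\<chi> i. ev (x $ i) \<theta>)"

definition mat_ev :: "('x \<Rightarrow> complex \<Rightarrow> complex) \<Rightarrow> 'x^'m^'n \<Rightarrow> complex \<Rightarrow> complex^'m^'n"
  where "mat_ev ev B \<theta> = (\<chi> i j. ev (B $ i $ j) \<theta>)"

definition vec_smul :: "(complex \<Rightarrow> 'x \<Rightarrow> 'x) \<Rightarrow> complex \<Rightarrow> 'x^'n \<Rightarrow> 'x^'n"
  where "vec_smul smul c x = (\<chi> i. smul c (x $ i))"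

text \<open>
  The library norm on \<open>'x^'n\<close> is the Euclidean combination of the component norms; the norm used
  here is their maximum. Both induce the same topology, so limits, series and integrals in
  \<open>'x^'n\<close> do not depend on the choice.
\<close>

definition max_norm :: "('x::real_normed_vector)^'n \<Rightarrow> real"
  where "max_norm x = Max (range (\<lambda>i. norm (x $ i)))"

definition bounded_linear_op ::
  "(complex \<Rightarrow> 'a::ab_group_add \<Rightarrow> 'a) \<Rightarrow> ('a \<Rightarrow> real) \<Rightarrow>
   (complex \<Rightarrow> 'b::ab_group_add \<Rightarrow> 'b) \<Rightarrow> ('b \<Rightarrow> real) \<Rightarrow> ('a \<Rightarrow> 'b) \<Rightarrow> bool"
  where "bounded_linear_op s1 N1 s2 N2 F \<longleftrightarrow>
    Vector_Spaces.linear s1 s2 F \<and> (\<exists>K. \<forall>x. N2 (F x) \<le> K * N1 x)"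

definition represents ::
  "complex set \<Rightarrow> ('x \<Rightarrow> complex \<Rightarrow> complex) \<Rightarrow> 'x^'n \<Rightarrow> (complex \<Rightarrow> complex^'n) \<Rightarrow> bool"
  where "represents P ev g h \<longleftrightarrow> (\<forall>\<theta>\<in>P. vec_ev ev g \<theta> = h \<theta>)"

text \<open>The element of the space given by the function \<open>h\<close>, meaningful if \<open>h\<close> is represented at all.\<close>

definition vec_elem ::
  "complex set \<Rightarrow> ('x \<Rightarrow> complex \<Rightarrow> complex) \<Rightarrow> (complex \<Rightarrow> complex^'n) \<Rightarrow> 'x^'n"
  where "vec_elem P ev h = (THE g. represents P ev g h)"

definition mult_op ::
  "complex set \<Rightarrow> ('x \<Rightarrow> complex \<Rightarrow> complex) \<Rightarrow> (complex \<Rightarrow> complex^'n^'n) \<Rightarrow> 'x^'n \<Rightarrow> 'x^'n"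
  where "mult_op P ev A f = vec_elem P ev (\<lambda>\<theta>. A \<theta> *v vec_ev ev f \<theta>)"

definition input_op ::
  "complex set \<Rightarrow> ('x \<Rightarrow> complex \<Rightarrow> complex) \<Rightarrow> 'x^'m^'n \<Rightarrow> complex^'m \<Rightarrow> 'x^'n"
  where "input_op P ev B v = vec_elem P ev (\<lambda>\<theta>. mat_ev ev B \<theta> *v v)"

definition continuous_matrix :: "complex set \<Rightarrow> (complex \<Rightarrow> complex^'m^'n) \<Rightarrow> bool"
  where "continuous_matrix P A \<longleftrightarrow> (\<forall>i j. continuous_on P (\<lambda>\<theta>. A \<theta> $ i $ j))"

text \<open>The operator exponential \<open>exp (t G)\<close>, as its power series applied to \<open>x\<close>.\<close>

definition op_exp :: "real \<Rightarrow> ('a::real_normed_vector \<Rightarrow> 'a) \<Rightarrow> 'a \<Rightarrow> 'a"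
  where "op_exp t G x = (\<Sum>k. (t ^ k / fact k) *\<^sub>R (G ^^ k) x)"

definition ct_solution ::
  "('a::{banach, second_countable_topology} \<Rightarrow> 'a) \<Rightarrow> ('u \<Rightarrow> 'a) \<Rightarrow> (real \<Rightarrow> 'u) \<Rightarrow> real \<Rightarrow> 'a"
  where "ct_solution G B u T = (LINT \<tau>:{0..T}|lebesgue. op_exp (T - \<tau>) G (B (u \<tau>)))"

definition dt_solution ::
  "('a::comm_monoid_add \<Rightarrow> 'a) \<Rightarrow> ('u \<Rightarrow> 'a) \<Rightarrow> (nat \<Rightarrow> 'u) \<Rightarrow> nat \<Rightarrow> 'a"
  where "dt_solution G B u T = (\<Sum>k<T. (G ^^ (T - 1 - k)) (B (u k)))"

definition ct_ensemble_reachable ::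
  "(('x::{banach, second_countable_topology})^'n \<Rightarrow> 'x^'n) \<Rightarrow> (complex^'m \<Rightarrow> 'x^'n) \<Rightarrow> bool"
  where "ct_ensemble_reachable G B \<longleftrightarrow>
    (\<forall>f. \<forall>\<epsilon>>0. \<exists>T\<ge>0. \<exists>u. u absolutely_integrable_on {0..T} \<and>
       max_norm (ct_solution G B u T - f) < \<epsilon>)"

definition dt_ensemble_reachable ::
  "(('x::{banach, second_countable_topology})^'n \<Rightarrow> 'x^'n) \<Rightarrow> (complex^'m \<Rightarrow> 'x^'n) \<Rightarrow> bool"
  where "dt_ensemble_reachable G B \<longleftrightarrow>
    (\<forall>f. \<forall>\<epsilon>>0. \<exists>T u. max_norm (dt_solution G B u T - f) < \<epsilon>)"

context banach_function_space
begin

lemma represents_vec_elem: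
  fixes g :: "'x^'n"
  assumes "represents P ev g h"
  shows "vec_elem P ev h = g"
  unfolding vec_elem_def
proof (rule the_equality)
  show "represents P ev g h" by (fact assms)
next
  fix g' :: "'x^'n" assume "represents P ev g' h"
  with assms have "ev (g' $ i) \<theta> = ev (g $ i) \<theta>" if "\<theta> \<in> P" for \<theta> i
    using that unfolding represents_def vec_ev_def vec_eq_iff by simp
  then show "g' = g" unfolding vec_eq_iff by (intro allI ev_inject)
qed

lemma ev_sum: "\<theta> \<in> P \<Longrightarrow> ev (sum g S) \<theta> = (\<Sum>j\<in>S. ev (g j) \<theta>)"
proof (induction S rule: infinite_finite_induct)
  case (insert j S)
  then show ?case by (simp add: ev_add)
qed (use ev_add[of \<theta> 0 0] in auto)

lemma input_op_eq:
  fixes B :: "'x^'m^'n"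
  shows "input_op P ev B v = (\<chi> i. \<Sum>j\<in>UNIV. smul (v $ j) (B $ i $ j))"
  unfolding input_op_def
  by (rule represents_vec_elem)
    (auto simp: represents_def vec_ev_def mat_ev_def matrix_vector_mult_def ev_sum ev_smul
      mult.commute)

end

end

theory Submission
  imports Defs
begin

text \<open>
  In either time setting, reachability says that one and the same subspace is dense: the span
  of all vectors \<open>G\<^sup>k (B v)\<close>, called \<open>krylov_space G B\<close> below. This is the
  infinite-dimensional form of Kalman's rank condition. The subspace does not change under
  feedback (\<open>krylov_space_feedback\<close>): it contains the range of \<open>B\<close> and is invariant
  under \<open>G\<close>, hence it is invariant under \<open>G + B F\<close>; the reverse inclusion is the
  same statement for the feedback \<open>- F\<close> applied to \<open>G + B F\<close>. So reachability
  of the two pairs is one condition.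

  In discrete time the reachable states are exactly the elements of the Krylov space
  (\<open>dt_reachable_set\<close>). In continuous time the reachable states and the Krylov space have
  the same closure (\<open>closure_ct_solutions\<close>), for two reasons. Integrating the exponential
  series term by term writes the final state as \<open>\<Sum>k. G\<^sup>k (B w\<^sub>k)\<close>, where
  \<open>w\<^sub>k\<close> is the integral of \<open>(T - \<tau>)\<^sup>k / k! u(\<tau>)\<close>
  (\<open>ct_solution_sums\<close>); its partial sums lie in the Krylov space. Conversely, a constant
  pulse \<open>v\<close> during the last \<open>h\<close> time units of \<open>[0, 1]\<close> leads to the state
  \<open>\<Sum>k. h^(k+1) / (k+1)! G\<^sup>k (B v)\<close>. This is a power series in
  \<open>h\<close> all of whose values lie in one closed subspace, the closure of the states
  reachable at time \<open>1\<close>, and therefore so do its coefficients (\<open>power_series_coefficients_in_closed_subspace\<close>).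

  The span is taken with real scalars. For complex-linear \<open>G\<close> and \<open>B\<close> it is the
  complex span as well, because \<open>c (G\<^sup>k (B v)) = G\<^sup>k (B (c v))\<close> is again one of the
  generators. The maximum norm may be replaced by the equivalent Euclidean one.
\<close>

section \<open>The Krylov space\<close>

definition krylov_space :: "('a::real_vector \<Rightarrow> 'a) \<Rightarrow> ('u \<Rightarrow> 'a) \<Rightarrow> 'a set"
  where "krylov_space G B = span (\<Union>k. range (\<lambda>v. (G ^^ k) (B v)))"

lemma input_in_krylov_space: "B v \<in> krylov_space G B"
  unfolding krylov_space_def by (rule span_base) (auto intro!: exI[of _ "0::nat"])

lemma krylov_space_invariant:
  assumes "linear G" "x \<in> krylov_space G B"
  shows "G x \<in> krylov_space G B"
proof -
  have "G ` (\<Union>k. range (\<lambda>v. (G ^^ k) (B v))) \<subseteq> (\<Union>k. range (\<lambda>v. (G ^^ k) (B v)))"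
  proof clarify
    fix k v
    show "G ((G ^^ k) (B v)) \<in> (\<Union>k. range (\<lambda>v. (G ^^ k) (B v)))"
      by (rule UN_I[of "Suc k"]) auto
  qed
  then have "span (G ` (\<Union>k. range (\<lambda>v. (G ^^ k) (B v)))) \<subseteq> krylov_space G B"
    unfolding krylov_space_def by (rule span_mono)
  moreover have "G x \<in> span (G ` (\<Union>k. range (\<lambda>v. (G ^^ k) (B v))))"
    using assms(2) unfolding linear_span_image[OF assms(1)] krylov_space_def by (rule imageI)
  ultimately show ?thesis ..
qed

text \<open>
  One feedback step adds to \<open>G x\<close> an element of the range of \<open>B\<close>, so by
  induction the closed loop never leaves the Krylov space.
\<close>

lemma krylov_space_feedback_subset:
  assumes "linear G"
  shows "krylov_space (\<lambda>x. G x + B (F x)) B \<subseteq> krylov_space G B"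
proof -
  have "((\<lambda>x. G x + B (F x)) ^^ k) (B v) \<in> krylov_space G B" for k v
  proof (induction k)
    case 0
    show ?case by (simp add: input_in_krylov_space)
  next
    case (Suc k)
    have "subspace (krylov_space G B)"
      unfolding krylov_space_def by simp
    then show ?case
      using krylov_space_invariant[OF assms Suc] by (simp add: subspace_add input_in_krylov_space)
  qed
  then have "span (\<Union>k. range (\<lambda>v. ((\<lambda>x. G x + B (F x)) ^^ k) (B v))) \<subseteq> krylov_space G B"
    by (intro span_minimal UN_least image_subsetI) (simp_all only: krylov_space_def subspace_span)
  then show ?thesis
    by (simp only: krylov_space_def[of "\<lambda>x. G x + B (F x)"])
qed

text \<open>
  Applying the feedback \<open>- F\<close> to \<open>G + B F\<close> gives back \<open>G\<close>, so the
  inclusion above holds in both directions.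
\<close>

lemma krylov_space_feedback:
  assumes "linear G" "linear B" "linear F"
  shows "krylov_space (\<lambda>x. G x + B (F x)) B = krylov_space G B"
proof
  show "krylov_space (\<lambda>x. G x + B (F x)) B \<subseteq> krylov_space G B"
    by (rule krylov_space_feedback_subset[OF assms(1)])
  have "linear (\<lambda>x. G x + B (F x))"
    using linear_compose_add[OF assms(1) linear_compose[OF assms(3,2)]] by (simp add: o_def)
  from krylov_space_feedback_subset[OF this, of B "\<lambda>x. - F x"]
  show "krylov_space G B \<subseteq> krylov_space (\<lambda>x. G x + B (F x)) B"
    by (simp add: linear_neg[OF assms(2)])
qed

text \<open>
  Since \<open>B\<close> is linear, every vector in the span needs only one input per power of
  \<open>G\<close>. Sums of different lengths are added after padding them with zero inputs.
\<close>

lemma krylov_space_eq_sums: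
  fixes G :: "'a::real_vector \<Rightarrow> 'a"
  assumes G: "linear G" and B: "linear B"
  shows "krylov_space G B = {\<Sum>k<N. (G ^^ k) (B (w k)) |N w. True}" (is "_ = ?S")
proof
  have lin: "linear (\<lambda>v. (G ^^ k) (B v))" for k
  proof (induction k)
    case (Suc k)
    from linear_compose[OF Suc G] show ?case by (simp add: o_def)
  qed (simp add: B)
  note add = linear_add[OF lin] and scale = linear_scale[OF lin] and zero = linear_0[OF lin]
  have pad: "(\<Sum>k<N. (G ^^ k) (B (w k))) = (\<Sum>k<M. (G ^^ k) (B (if k < N then w k else 0)))"
    if "N \<le> M" for N M :: nat and w
    using that by (intro sum.mono_neutral_cong_left) (auto simp: zero)
  show "krylov_space G B \<subseteq> ?S"
    unfolding krylov_space_def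
  proof (rule span_minimal)
    show "(\<Union>k. range (\<lambda>v. (G ^^ k) (B v))) \<subseteq> ?S"
    proof clarify
      fix k v
      have "(G ^^ k) (B v) = (\<Sum>j<Suc k. (G ^^ j) (B (if j = k then v else 0)))"
        by (simp add: zero)
      then show "\<exists>N w. (G ^^ k) (B v) = (\<Sum>k<N. (G ^^ k) (B (w k))) \<and> True"
        by (intro exI conjI TrueI)
    qed
    show "subspace ?S"
    proof (rule subspaceI)
      show "0 \<in> ?S" by (auto intro!: exI[of _ "0::nat"])
    next
      fix x y assume "x \<in> ?S" "y \<in> ?S"
      then obtain N w M w' where
        "x = (\<Sum>k<N. (G ^^ k) (B (w k)))" "y = (\<Sum>k<M. (G ^^ k) (B (w' k)))" by blast
      then have "x + y = (\<Sum>k<max N M. (G ^^ k)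
          (B ((if k < N then w k else 0) + (if k < M then w' k else 0))))"
        by (simp add: add sum.distrib pad[of N "max N M" w] pad[of M "max N M" w'])
      then show "x + y \<in> ?S"
        by (intro CollectI exI conjI TrueI)
    next
      fix c x assume "x \<in> ?S"
      then obtain N w where "x = (\<Sum>k<N. (G ^^ k) (B (w k)))" by blast
      then have "c *\<^sub>R x = (\<Sum>k<N. (G ^^ k) (B (c *\<^sub>R w k)))"
        by (simp add: scale scaleR_sum_right)
      then show "c *\<^sub>R x \<in> ?S"
        by (intro CollectI exI conjI TrueI)
    qed
  qed
  show "?S \<subseteq> krylov_space G B"
  proof clarify
    fix N w
    show "(\<Sum>k<N. (G ^^ k) (B (w k))) \<in> krylov_space G B"
      unfolding krylov_space_def by (rule span_sum, rule span_base) blast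
  qed
qed

lemma dt_solution_rev: "dt_solution G B u T = (\<Sum>k<T. (G ^^ k) (B (u (T - 1 - k))))"
  unfolding dt_solution_def
  by (rule sum.reindex_bij_witness[of _ "\<lambda>k. T - 1 - k" "\<lambda>k. T - 1 - k"]) auto

lemma dt_reachable_set:
  assumes "linear G" "linear B"
  shows "{dt_solution G B u T |u T. True} = krylov_space G B"
  unfolding krylov_space_eq_sums[OF assms]
proof (intro Collect_cong iffI)
  fix x assume "\<exists>u T. x = dt_solution G B u T \<and> True"
  then obtain u T where "x = dt_solution G B u T" by blast
  then show "\<exists>N w. x = (\<Sum>k<N. (G ^^ k) (B (w k))) \<and> True"
    by (intro exI conjI TrueI) (simp add: dt_solution_rev)
next
  fix x assume "\<exists>N w. x = (\<Sum>k<N. (G ^^ k) (B (w k))) \<and> True"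
  then obtain N w where "x = (\<Sum>k<N. (G ^^ k) (B (w k)))" by blast
  then have "x = dt_solution G B (\<lambda>k. w (N - 1 - k)) N"
    unfolding dt_solution_rev by (auto intro!: sum.cong arg_cong[where f = w])
  then show "\<exists>u T. x = dt_solution G B u T \<and> True" by blast
qed

section \<open>Power series with values in a closed subspace\<close>

lemma norm_suminf_geometric_weights_le:
  fixes c :: "nat \<Rightarrow> 'a::banach" and h :: real
  assumes "summable (\<lambda>k. norm (c k))" "0 \<le> h" "h \<le> 1"
  shows "summable (\<lambda>k. norm (h ^ k *\<^sub>R c k))"
    and "norm (\<Sum>k. h ^ k *\<^sub>R c k) \<le> (\<Sum>k. norm (c k))"
proof -
  have le: "norm (h ^ k *\<^sub>R c k) \<le> norm (c k)" for k
    using assms(2,3) by (simp add: mult_left_le_one_le power_le_one)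
  show *: "summable (\<lambda>k. norm (h ^ k *\<^sub>R c k))"
    by (rule summable_comparison_test'[OF assms(1)]) (use le in simp)
  show "norm (\<Sum>k. h ^ k *\<^sub>R c k) \<le> (\<Sum>k. norm (c k))"
    using summable_norm[OF *] suminf_le[OF le * assms(1)] by linarith
qed

lemma power_series_split_head:
  fixes c :: "nat \<Rightarrow> 'a::banach" and h :: real
  assumes "summable (\<lambda>k. norm (c k))" "0 \<le> h" "h \<le> 1"
  shows "(\<Sum>k. h ^ k *\<^sub>R c k) = c 0 + h *\<^sub>R (\<Sum>k. h ^ k *\<^sub>R c (Suc k))"
proof -
  have "summable (\<lambda>k. norm (c (Suc k)))"
    using assms(1) by (subst summable_Suc_iff)
  from summable_norm_cancel[OF norm_suminf_geometric_weights_le(1)[OF this assms(2,3)]]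
  have "(\<Sum>k. h ^ Suc k *\<^sub>R c (Suc k)) = h *\<^sub>R (\<Sum>k. h ^ k *\<^sub>R c (Suc k))"
    by (simp add: suminf_scaleR_right)
  with suminf_split_head[OF summable_norm_cancel[OF norm_suminf_geometric_weights_le(1)[OF assms]]]
  show ?thesis by (simp add: diff_eq_eq add.commute)
qed

text \<open>
  Away from the constant term the series is of order \<open>h\<close>, so its values at
  \<open>h = 1 / (n + 1)\<close> converge to \<open>c 0\<close>.
\<close>

lemma power_series_head_in_closed:
  fixes c :: "nat \<Rightarrow> 'a::banach"
  assumes "closed S" and sm: "summable (\<lambda>k. norm (c k))"
    and mem: "\<And>h. 0 < h \<Longrightarrow> h \<le> 1 \<Longrightarrow> (\<Sum>k. h ^ k *\<^sub>R c k) \<in> S"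
  shows "c 0 \<in> S"
proof -
  define g where "g h = (\<Sum>k. h ^ k *\<^sub>R c k)" for h :: real
  define M where "M = (\<Sum>k. norm (c (Suc k)))"
  have tail: "norm (g h - c 0) \<le> h * M" if h: "0 < h" "h \<le> 1" for h
  proof -
    have "norm (g h - c 0) = h * norm (\<Sum>k. h ^ k *\<^sub>R c (Suc k))"
      using power_series_split_head[OF sm, of h] h by (simp add: g_def)
    also have "\<dots> \<le> h * M"
      unfolding M_def using sm h
      by (intro mult_left_mono norm_suminf_geometric_weights_le)
        (simp_all add: summable_Suc_iff[of "\<lambda>k. norm (c k)"])
    finally show ?thesis .
  qed
  have "(\<lambda>n. g (1 / real (Suc n)) - c 0) \<longlonglongrightarrow> 0"
  proof (rule Lim_null_comparison)
    show "\<forall>\<^sub>F n in sequentially. norm (g (1 / real (Suc n)) - c 0) \<le> 1 / real (Suc n) * M"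
      by (intro always_eventually allI tail) simp_all
    show "(\<lambda>n. 1 / real (Suc n) * M) \<longlonglongrightarrow> 0"
      by (rule tendsto_mult_left_zero) (rule LIMSEQ_Suc[OF lim_1_over_n])
  qed
  then have "(\<lambda>n. g (1 / real (Suc n))) \<longlonglongrightarrow> c 0"
    by (simp add: LIM_zero_iff)
  moreover have "g (1 / real (Suc n)) \<in> S" for n
    unfolding g_def by (rule mem) simp_all
  ultimately show ?thesis
    by (rule closed_sequentially[OF \<open>closed S\<close>, rotated])
qed

text \<open>
  Once the constant term is known to be in \<open>S\<close>, subtracting it and dividing by
  \<open>h\<close> gives a series of the same kind with all coefficients shifted down by one. In
  this way the coefficients, which are derivatives at \<open>0\<close> up to factorials, are
  obtained without differentiating.
\<close>

lemma power_series_coefficients_in_closed_subspace: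
  fixes c :: "nat \<Rightarrow> 'a::banach"
  assumes "subspace S" "closed S" "summable (\<lambda>k. norm (c k))"
    and "\<And>h. 0 < h \<Longrightarrow> h \<le> 1 \<Longrightarrow> (\<Sum>k. h ^ k *\<^sub>R c k) \<in> S"
  shows "c n \<in> S"
  using assms(3,4)
proof (induction n arbitrary: c)
  case (0 c)
  then show ?case by (rule power_series_head_in_closed[OF \<open>closed S\<close>])
next
  case (Suc n c)
  have "c 0 \<in> S"
    by (rule power_series_head_in_closed[OF \<open>closed S\<close> Suc.prems])
  have "(\<Sum>k. h ^ k *\<^sub>R c (Suc k)) \<in> S" if h: "0 < h" "h \<le> 1" for h
  proof -
    have "(\<Sum>k. h ^ k *\<^sub>R c (Suc k)) = (1 / h) *\<^sub>R ((\<Sum>k. h ^ k *\<^sub>R c k) - c 0)"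
      using power_series_split_head[OF Suc.prems(1), of h] h by simp
    then show ?thesis
      using Suc.prems(2)[OF h] \<open>c 0 \<in> S\<close> \<open>subspace S\<close>
      by (simp add: subspace_diff subspace_scale)
  qed
  moreover have "summable (\<lambda>k. norm (c (Suc k)))"
    using Suc.prems(1) by (subst summable_Suc_iff)
  ultimately show ?case by (rule Suc.IH[rotated])
qed

lemma subspace_closure:
  fixes S :: "'a::real_normed_vector set"
  assumes "subspace S"
  shows "subspace (closure S)"
proof (rule subspaceI)
  show "0 \<in> closure S"
    using assms closure_subset subspace_0 by blast
next
  fix x y assume "x \<in> closure S" "y \<in> closure S"
  then obtain f g where f: "\<forall>n::nat. f n \<in> S" "f \<longlonglongrightarrow> x" and g: "\<forall>n. g n \<in> S" "g \<longlonglongrightarrow> y"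
    unfolding closure_sequential by blast
  show "x + y \<in> closure S"
    unfolding closure_sequential
    using f g assms by (intro exI[of _ "\<lambda>n. f n + g n"] conjI tendsto_add allI subspace_add) blast+
next
  fix c x assume "x \<in> closure S"
  then obtain f where f: "\<forall>n::nat. f n \<in> S" "f \<longlonglongrightarrow> x"
    unfolding closure_sequential by blast
  show "c *\<^sub>R x \<in> closure S"
    unfolding closure_sequential
    using f assms
    by (intro exI[of _ "\<lambda>n. c *\<^sub>R f n"] conjI tendsto_scaleR[OF tendsto_const] allI subspace_scale) blast+
qed

section \<open>Moments of the input\<close>

text \<open>
  The coefficient vector that the input contributes to the term \<open>G\<^sup>k\<close> of the
  exponential series.
\<close>

definition control_moment :: "real \<Rightarrow> (real \<Rightarrow> 'u::euclidean_space) \<Rightarrow> nat \<Rightarrow> 'u"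
  where "control_moment T u k = (LINT \<tau>:{0..T}|lebesgue. ((T - \<tau>) ^ k / fact k) *\<^sub>R u \<tau>)"

lemma moment_weight_le:
  fixes T \<tau> :: real
  assumes "0 \<le> T"
  shows "norm (indicator {0..T} \<tau> *\<^sub>R ((T - \<tau>) ^ k / fact k) *\<^sub>R x)
    \<le> T ^ k / fact k * norm (indicator {0..T} \<tau> *\<^sub>R x)"
  using assms by (auto simp: indicator_def power_mono intro!: mult_right_mono divide_right_mono)

lemma control_moment_integrable:
  fixes u :: "real \<Rightarrow> 'u::euclidean_space"
  assumes "0 \<le> T" and u: "u absolutely_integrable_on {0..T}"
  shows "integrable lebesgue (\<lambda>\<tau>. indicator {0..T} \<tau> *\<^sub>R ((T - \<tau>) ^ k / fact k) *\<^sub>R u \<tau>)"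
proof (rule Bochner_Integration.integrable_bound)
  have eq: "(\<lambda>\<tau>. indicator {0..T} \<tau> *\<^sub>R ((T - \<tau>) ^ k / fact k) *\<^sub>R u \<tau>)
      = (\<lambda>\<tau>. ((T - \<tau>) ^ k / fact k) *\<^sub>R (indicator {0..T} \<tau> *\<^sub>R u \<tau>))"
    by (simp add: mult.commute)
  show "integrable lebesgue (\<lambda>\<tau>. (T ^ k / fact k) *\<^sub>R (indicator {0..T} \<tau> *\<^sub>R u \<tau>))"
    using u unfolding set_integrable_def by (rule integrable_scaleR_right)
  have "(\<lambda>\<tau>. indicator {0..T} \<tau> *\<^sub>R u \<tau>) \<in> borel_measurable lebesgue"
    using u unfolding set_integrable_def by (rule borel_measurable_integrable)
  moreover have "(\<lambda>\<tau>. (T - \<tau>) ^ k / fact k) \<in> borel_measurable lebesgue"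
    by (rule measurable_completion) simp
  ultimately have "(\<lambda>\<tau>. ((T - \<tau>) ^ k / fact k) *\<^sub>R (indicator {0..T} \<tau> *\<^sub>R u \<tau>)) \<in> borel_measurable lebesgue"
    by (rule borel_measurable_scaleR[rotated])
  then show "(\<lambda>\<tau>. indicator {0..T} \<tau> *\<^sub>R ((T - \<tau>) ^ k / fact k) *\<^sub>R u \<tau>) \<in> borel_measurable lebesgue"
    unfolding eq .
  show "AE \<tau> in lebesgue. norm (indicator {0..T} \<tau> *\<^sub>R ((T - \<tau>) ^ k / fact k) *\<^sub>R u \<tau>)
      \<le> norm ((T ^ k / fact k) *\<^sub>R (indicator {0..T} \<tau> *\<^sub>R u \<tau>))"
  proof (rule AE_I2)
    fix \<tau>
    show "norm (indicator {0..T} \<tau> *\<^sub>R ((T - \<tau>) ^ k / fact k) *\<^sub>R u \<tau>)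
        \<le> norm ((T ^ k / fact k) *\<^sub>R (indicator {0..T} \<tau> *\<^sub>R u \<tau>))"
      using moment_weight_le[OF \<open>0 \<le> T\<close>, of \<tau> k "u \<tau>"] \<open>0 \<le> T\<close>
      by (simp only: norm_scaleR[of "T ^ k / fact k"]) simp
  qed
qed

lemma control_moment_add:
  assumes "0 \<le> T" "u absolutely_integrable_on {0..T}" "u' absolutely_integrable_on {0..T}"
  shows "control_moment T (\<lambda>\<tau>. u \<tau> + u' \<tau>) k = control_moment T u k + control_moment T u' k"
  using control_moment_integrable[OF assms(1,2)] control_moment_integrable[OF assms(1,3)]
  by (simp add: control_moment_def set_lebesgue_integral_def scaleR_add_right)

lemma control_moment_scale: "control_moment T (\<lambda>\<tau>. c *\<^sub>R u \<tau>) k = c *\<^sub>R control_moment T u k"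
proof -
  have "(\<lambda>\<tau>. indicator {0..T} \<tau> *\<^sub>R ((T - \<tau>) ^ k / fact k) *\<^sub>R c *\<^sub>R u \<tau>)
      = (\<lambda>\<tau>. c *\<^sub>R (indicator {0..T} \<tau> *\<^sub>R ((T - \<tau>) ^ k / fact k) *\<^sub>R u \<tau>))"
    by (simp add: mult_ac)
  then show ?thesis
    by (simp only: control_moment_def set_lebesgue_integral_def integral_scaleR_right)
qed

text \<open>
  Pulses at the end of the time interval have moments that are constant multiples of
  powers of their length; this is what makes the final state a power series in the length.
\<close>

lemma control_moment_end_pulse:
  fixes v :: "'u::euclidean_space"
  assumes "0 < h" "h \<le> 1"
  shows "control_moment 1 (\<lambda>\<tau>. indicator {1 - h..1} \<tau> *\<^sub>R v) k = (h ^ Suc k / fact (Suc k)) *\<^sub>R v"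
proof -
  have "control_moment 1 (\<lambda>\<tau>. indicator {1 - h..1} \<tau> *\<^sub>R v) k
      = (\<integral>\<tau>. ((1 - \<tau>) ^ k / fact k * indicator {1 - h..1} \<tau>) *\<^sub>R v \<partial>lebesgue)"
    unfolding control_moment_def set_lebesgue_integral_def
    using assms by (intro Bochner_Integration.integral_cong) (auto simp: indicator_def)
  also have "\<dots> = (h ^ Suc k / fact (Suc k)) *\<^sub>R v"
  proof -
    let ?w = "\<lambda>\<tau> :: real. (1 - \<tau>) ^ k / fact k * indicator {1 - h..1} \<tau>"
    have "has_bochner_integral lborel ?w
        (- ((1 - 1) ^ Suc k / fact (Suc k)) - - ((1 - (1 - h)) ^ Suc k / fact (Suc k)))"
    proof (rule has_bochner_integral_FTC_Icc_real)
      fix x :: real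
      show "DERIV (\<lambda>\<tau>. - ((1 - \<tau>) ^ Suc k / fact (Suc k))) x :> (1 - x) ^ k / fact k"
        by (rule derivative_eq_intros refl | simp)+
    qed (use assms in auto)
    then have "has_bochner_integral lebesgue ?w (h ^ Suc k / fact (Suc k))"
      by (simp add: has_bochner_integral_iff integrable_completion integral_completion del: fact_Suc)
    then show ?thesis
      by (simp add: has_bochner_integral_iff integral_scaleR_left del: fact_Suc)
  qed
  finally show ?thesis .
qed

section \<open>Continuous-time reachable states\<close>

locale control_system =
  fixes G :: "'a::{banach, second_countable_topology} \<Rightarrow> 'a" and B :: "'u::euclidean_space \<Rightarrow> 'a"
  assumes bounded_linear_G: "bounded_linear G" and bounded_linear_B: "bounded_linear B"
begin

lemma linear_G: "linear G" and linear_B: "linear B"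
  using bounded_linear_G bounded_linear_B by (simp_all add: bounded_linear.linear)

lemma bounded_linear_iterate: "bounded_linear (\<lambda>v. (G ^^ k) (B v))"
proof (induction k)
  case (Suc k)
  from bounded_linear_compose[OF bounded_linear_G Suc] show ?case by simp
qed (simp add: bounded_linear_B)

lemma iterate_bound:
  obtains C K :: real where "0 \<le> C" "0 \<le> K" "\<And>k v. norm ((G ^^ k) (B v)) \<le> C * K ^ k * norm v"
proof -
  obtain K where K: "0 \<le> K" "\<And>x. norm (G x) \<le> norm x * K"
    using bounded_linear.nonneg_bounded[OF bounded_linear_G] by blast
  obtain C where C: "0 \<le> C" "\<And>v. norm (B v) \<le> norm v * C"
    using bounded_linear.nonneg_bounded[OF bounded_linear_B] by blast
  have "norm ((G ^^ k) (B v)) \<le> C * K ^ k * norm v" for k v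
  proof (induction k)
    case 0
    show ?case using C(2)[of v] by (simp add: mult.commute)
  next
    case (Suc k)
    have "norm ((G ^^ Suc k) (B v)) \<le> norm ((G ^^ k) (B v)) * K"
      using K(2) by simp
    also have "\<dots> \<le> C * K ^ k * norm v * K"
      by (rule mult_right_mono[OF Suc K(1)])
    finally show ?case by (simp add: mult_ac)
  qed
  with C(1) K(1) show thesis by (rule that)
qed

text \<open>
  The exponential series may be integrated term by term, because its \<open>k\<close>-th term is
  bounded by \<open>C (K T)\<^sup>k / k! \<bar>u(\<tau>)\<bar>\<close>, where \<open>K\<close> bounds
  \<open>G\<close> and \<open>C\<close> bounds \<open>B\<close>. As the \<open>k\<close>-th term depends linearly on
  \<open>u(\<tau>)\<close>, its integral only involves a moment of \<open>u\<close>.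
\<close>

lemma ct_solution_sums:
  assumes T: "0 \<le> T" and u: "u absolutely_integrable_on {0..T}"
  shows "(\<lambda>k. (G ^^ k) (B (control_moment T u k))) sums ct_solution G B u T"
proof -
  obtain C K where CK: "0 \<le> C" "0 \<le> K" "\<And>k v. norm ((G ^^ k) (B v)) \<le> C * K ^ k * norm v"
    using iterate_bound by blast
  define f where "f k \<tau> = (G ^^ k) (B (indicator {0..T} \<tau> *\<^sub>R ((T - \<tau>) ^ k / fact k) *\<^sub>R u \<tau>))"
    for k \<tau>
  define U where "U \<tau> = norm (indicator {0..T} \<tau> *\<^sub>R u \<tau>)" for \<tau>
  define a where "a k = C * ((K * T) ^ k / fact k)" for k
  have U: "integrable lebesgue U"
    using u unfolding U_def set_integrable_def by (rule integrable_norm)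
  have int: "integrable lebesgue (f k)" for k
    unfolding f_def
    by (rule integrable_bounded_linear[OF bounded_linear_iterate control_moment_integrable[OF T u]])
  have bound: "norm (f k \<tau>) \<le> a k * U \<tau>" for k \<tau>
  proof -
    have "norm (f k \<tau>) \<le> C * K ^ k * (T ^ k / fact k * U \<tau>)"
      unfolding f_def U_def
      using CK by (intro order_trans[OF CK(3) mult_left_mono[OF moment_weight_le[OF T]]]) simp_all
    then show ?thesis by (simp add: a_def power_mult_distrib mult_ac)
  qed
  have a: "summable a"
    unfolding a_def using summable_exp[of "K * T"]
    by (intro summable_mult) (simp add: divide_inverse mult.commute)
  have AE: "AE \<tau> in lebesgue. summable (\<lambda>k. norm (f k \<tau>))"
  proof (rule AE_I2)
    fix \<tau>
    show "summable (\<lambda>k. norm (f k \<tau>))"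
      by (rule summable_comparison_test'[OF summable_mult2[OF a, of "U \<tau>"]]) (simp add: bound)
  qed
  have "(\<integral>\<tau>. norm (f k \<tau>) \<partial>lebesgue) \<le> a k * (\<integral>\<tau>. U \<tau> \<partial>lebesgue)" for k
    using integral_mono[OF integrable_norm[OF int] integrable_mult_right[OF U] bound] by simp
  then have "summable (\<lambda>k. \<integral>\<tau>. norm (f k \<tau>) \<partial>lebesgue)"
    by (intro summable_comparison_test'[OF summable_mult2[OF a, of "\<integral>\<tau>. U \<tau> \<partial>lebesgue"]]) simp
  from sums_integral[OF int AE this]
  have "(\<lambda>k. integral\<^sup>L lebesgue (f k)) sums (\<integral>\<tau>. (\<Sum>k. f k \<tau>) \<partial>lebesgue)" .
  moreover have "integral\<^sup>L lebesgue (f k) = (G ^^ k) (B (control_moment T u k))" for k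
    unfolding f_def control_moment_def set_lebesgue_integral_def
    by (rule integral_bounded_linear[OF bounded_linear_iterate control_moment_integrable[OF T u]])
  moreover have "(\<Sum>k. f k \<tau>) = indicator {0..T} \<tau> *\<^sub>R op_exp (T - \<tau>) G (B (u \<tau>))" for \<tau>
    by (simp add: f_def op_exp_def linear_scale[OF bounded_linear.linear[OF bounded_linear_iterate]]
        linear_0[OF bounded_linear.linear[OF bounded_linear_iterate]] indicator_def)
  ultimately show ?thesis
    by (simp add: ct_solution_def set_lebesgue_integral_def)
qed

lemma ct_solution_in_closure_krylov_space:
  assumes "0 \<le> T" "u absolutely_integrable_on {0..T}"
  shows "ct_solution G B u T \<in> closure (krylov_space G B)"
proof -
  have "(\<Sum>k<n. (G ^^ k) (B (control_moment T u k))) \<in> krylov_space G B" for n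
    unfolding krylov_space_eq_sums[OF linear_G linear_B] by blast
  with ct_solution_sums[OF assms] show ?thesis
    unfolding closure_sequential sums_def
    by (intro exI[of _ "\<lambda>n. \<Sum>k<n. (G ^^ k) (B (control_moment T u k))"]) simp
qed

text \<open>
  The horizon is fixed, so that sums of reachable states come from sums of inputs and no shift
  in time is needed.
\<close>

lemma subspace_ct_solutions:
  assumes "0 \<le> T"
  shows "subspace {ct_solution G B u T |u. u absolutely_integrable_on {0..T}}" (is "subspace ?R")
proof (rule subspaceI)
  have lin: "linear (\<lambda>v. (G ^^ k) (B v))" for k
    by (rule bounded_linear.linear[OF bounded_linear_iterate])
  show "x + y \<in> ?R" if "x \<in> ?R" "y \<in> ?R" for x y
  proof -
    from that obtain u u' where u: "x = ct_solution G B u T" "u absolutely_integrable_on {0..T}"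
      and u': "y = ct_solution G B u' T" "u' absolutely_integrable_on {0..T}" by blast
    have s: "(\<lambda>\<tau>. u \<tau> + u' \<tau>) absolutely_integrable_on {0..T}"
      using u(2) u'(2) by (rule set_integral_add)
    have "(\<lambda>k. (G ^^ k) (B (control_moment T (\<lambda>\<tau>. u \<tau> + u' \<tau>) k))) sums (x + y)"
      using sums_add[OF ct_solution_sums[OF assms u(2)] ct_solution_sums[OF assms u'(2)]] u u'
      by (simp add: control_moment_add[OF assms] linear_add[OF lin])
    from sums_unique2[OF this ct_solution_sums[OF assms s]] s show ?thesis by blast
  qed
  show scale: "c *\<^sub>R x \<in> ?R" if "x \<in> ?R" for c x
  proof -
    from that obtain u where u: "x = ct_solution G B u T" "u absolutely_integrable_on {0..T}" by blast
    have s: "(\<lambda>\<tau>. c *\<^sub>R u \<tau>) absolutely_integrable_on {0..T}"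
      using u(2) by simp
    have "(\<lambda>k. (G ^^ k) (B (control_moment T (\<lambda>\<tau>. c *\<^sub>R u \<tau>) k))) sums (c *\<^sub>R x)"
      using sums_scaleR_right[OF ct_solution_sums[OF assms u(2)], of c] u
      by (simp add: control_moment_scale linear_scale[OF lin])
    from sums_unique2[OF this ct_solution_sums[OF assms s]] s show ?thesis by blast
  qed
  have "ct_solution G B (\<lambda>_. 0) T \<in> ?R" by (auto simp: set_integrable_def)
  from scale[OF this, of 0] show "0 \<in> ?R" by simp
qed

text \<open>
  The final states under the pulses of length \<open>h\<close>, divided by \<open>h\<close>, form a power
  series in \<open>h\<close> with coefficients \<open>G\<^sup>k (B v) / (k + 1)!\<close>.
\<close>

lemma krylov_space_subset_closure_ct_solutions:
  "krylov_space G B \<subseteq> closure {ct_solution G B u 1 |u. u absolutely_integrable_on {0..1}}"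
    (is "_ \<subseteq> closure ?R")
  unfolding krylov_space_def
proof (rule span_minimal)
  show S: "subspace (closure ?R)"
    by (intro subspace_closure subspace_ct_solutions) simp
  have "(G ^^ n) (B v) \<in> closure ?R" for n v
  proof -
    have lin: "linear (\<lambda>v. (G ^^ k) (B v))" for k
      by (rule bounded_linear.linear[OF bounded_linear_iterate])
    define c where "c k = (1 / fact (Suc k)) *\<^sub>R (G ^^ k) (B v)" for k
    have "(\<Sum>k. h ^ k *\<^sub>R c k) \<in> closure ?R" if h: "0 < h" "h \<le> 1" for h
    proof -
      define u where "u \<tau> = indicator {1 - h..1} \<tau> *\<^sub>R v" for \<tau>
      have u: "u absolutely_integrable_on {0..1}"
      proof -
        have "integrable lebesgue (\<lambda>\<tau>. indicator {1 - h..1} \<tau> *\<^sub>R v)"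
          by (intro integrable_scaleR_left integrable_real_indicator)
            (use h in \<open>auto simp: emeasure_lborel_Icc\<close>)
        moreover have "(\<lambda>\<tau>. indicator {0..1} \<tau> *\<^sub>R u \<tau>) = (\<lambda>\<tau>. indicator {1 - h..1} \<tau> *\<^sub>R v)"
          using h by (auto simp: u_def indicator_def)
        ultimately show ?thesis
          unfolding set_integrable_def by simp
      qed
      have "(\<lambda>k. h *\<^sub>R (h ^ k *\<^sub>R c k)) sums ct_solution G B u 1"
      proof -
        have "control_moment 1 u k = (h ^ Suc k / fact (Suc k)) *\<^sub>R v" for k
          using control_moment_end_pulse[OF h, of v k] by (simp only: u_def[abs_def])
        with ct_solution_sums[OF zero_le_one u] show ?thesis
          by (simp add: linear_scale[OF lin] c_def del: fact_Suc)
      qed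
      from sums_scaleR_right[OF this, of "1 / h"]
      have "(\<Sum>k. h ^ k *\<^sub>R c k) = (1 / h) *\<^sub>R ct_solution G B u 1"
        using h by (simp add: sums_iff)
      moreover have "ct_solution G B u 1 \<in> closure ?R"
        using u by (intro subsetD[OF closure_subset]) blast
      ultimately show ?thesis
        using S by (simp add: subspace_scale)
    qed
    moreover have "summable (\<lambda>k. norm (c k))"
    proof -
      obtain C K where CK: "0 \<le> C" "0 \<le> K" "\<And>k v. norm ((G ^^ k) (B v)) \<le> C * K ^ k * norm v"
        using iterate_bound by blast
      have "norm (norm (c k)) \<le> C * norm v * (inverse (fact k) * K ^ k)" for k
      proof -
        have "norm (c k) \<le> (1 / fact k) * (C * K ^ k * norm v)"
          unfolding c_def norm_scaleR using CK
          by (intro mult_mono CK(3)) (auto simp: fact_mono divide_simps)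
        then show ?thesis by (simp add: divide_inverse mult_ac)
      qed
      then show ?thesis
        by (intro summable_comparison_test'[OF summable_mult[OF summable_exp[of K]]])
    qed
    ultimately have "c n \<in> closure ?R"
      by (rule power_series_coefficients_in_closed_subspace[OF S closed_closure, rotated])
    from subspace_scale[OF S this, of "fact (Suc n)"] show ?thesis
      by (simp add: c_def del: fact_Suc)
  qed
  then show "(\<Union>k. range (\<lambda>v. (G ^^ k) (B v))) \<subseteq> closure ?R" by blast
qed

lemma closure_ct_solutions:
  "closure {ct_solution G B u T |u T. 0 \<le> T \<and> u absolutely_integrable_on {0..T}}
    = closure (krylov_space G B)" (is "closure ?R = _")
proof
  have "?R \<subseteq> closure (krylov_space G B)"
    using ct_solution_in_closure_krylov_space by blast
  then show "closure ?R \<subseteq> closure (krylov_space G B)"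
    by (rule closure_minimal) (rule closed_closure)
  have "{ct_solution G B u 1 |u. u absolutely_integrable_on {0..1}} \<subseteq> ?R"
    using zero_le_one by blast
  then have "krylov_space G B \<subseteq> closure ?R"
    by (rule order_trans[OF krylov_space_subset_closure_ct_solutions closure_mono])
  then show "closure (krylov_space G B) \<subseteq> closure ?R"
    by (rule closure_minimal) (rule closed_closure)
qed

end

section \<open>The maximum norm\<close>

lemma max_norm_le_norm: "max_norm x \<le> norm x"
  unfolding max_norm_def by (rule Max.boundedI) (auto simp: Finite_Cartesian_Product.norm_nth_le)

lemma norm_component_le_max_norm: "norm (x $ i) \<le> max_norm x"
  unfolding max_norm_def by (rule Max_ge) auto

lemma max_norm_nonneg: "0 \<le> max_norm x"
  using norm_ge_zero norm_component_le_max_norm by (rule order_trans)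

lemma norm_le_card_max_norm:
  fixes x :: "'x::real_normed_vector ^ 'n"
  shows "norm x \<le> real CARD('n) * max_norm x"
proof -
  have "norm x \<le> (\<Sum>i\<in>UNIV. norm (x $ i))"
    unfolding norm_vec_def by (rule L2_set_le_sum) simp
  also have "\<dots> \<le> (\<Sum>i\<in>(UNIV::'n set). max_norm x)"
    by (rule sum_mono) (rule norm_component_le_max_norm)
  finally show ?thesis by simp
qed

lemma max_norm_approximable_iff_dense:
  fixes R :: "('x::real_normed_vector ^ 'n) set"
  shows "(\<forall>f. \<forall>\<epsilon>>0. \<exists>x\<in>R. max_norm (x - f) < \<epsilon>) \<longleftrightarrow> closure R = UNIV"
proof
  assume *: "\<forall>f. \<forall>\<epsilon>>0. \<exists>x\<in>R. max_norm (x - f) < \<epsilon>"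
  have "f \<in> closure R" for f
    unfolding closure_approachable
  proof (intro allI impI)
    fix \<epsilon> :: real assume "0 < \<epsilon>"
    then obtain x where x: "x \<in> R" "max_norm (x - f) < \<epsilon> / real CARD('n)"
      using * by (meson divide_pos_pos of_nat_0_less_iff zero_less_card_finite)
    then have "norm (x - f) < \<epsilon>"
      using norm_le_card_max_norm[of "x - f"]
      by (simp add: pos_less_divide_eq mult.commute)
    with x(1) show "\<exists>x\<in>R. dist x f < \<epsilon>"
      by (auto simp: dist_norm)
  qed
  then show "closure R = UNIV" by blast
next
  assume *: "closure R = UNIV"
  show "\<forall>f. \<forall>\<epsilon>>0. \<exists>x\<in>R. max_norm (x - f) < \<epsilon>"
  proof (intro allI impI)
    fix f and \<epsilon> :: real assume "0 < \<epsilon>"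
    moreover have "f \<in> closure R" using * by simp
    ultimately obtain x where "x \<in> R" "norm (x - f) < \<epsilon>"
      unfolding closure_approachable dist_norm by blast
    then show "\<exists>x\<in>R. max_norm (x - f) < \<epsilon>"
      using max_norm_le_norm[of "x - f"] by (intro bexI[of _ x]) auto
  qed
qed

section \<open>Reachability as density of the Krylov space\<close>

lemma ct_ensemble_reachable_iff_dense:
  assumes "bounded_linear G" "bounded_linear B"
  shows "ct_ensemble_reachable G B \<longleftrightarrow> closure (krylov_space G B) = UNIV"
proof -
  interpret control_system G B by (intro control_system.intro assms)
  have "(\<exists>x\<in>{ct_solution G B u T |u T. 0 \<le> T \<and> u absolutely_integrable_on {0..T}}. Q x) \<longleftrightarrow>
      (\<exists>T\<ge>0. \<exists>u. u absolutely_integrable_on {0..T} \<and> Q (ct_solution G B u T))" for Q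
    by blast
  then have "ct_ensemble_reachable G B \<longleftrightarrow>
      closure {ct_solution G B u T |u T. 0 \<le> T \<and> u absolutely_integrable_on {0..T}} = UNIV"
    by (simp only: ct_ensemble_reachable_def max_norm_approximable_iff_dense[symmetric])
  then show ?thesis by (simp only: closure_ct_solutions)
qed

lemma dt_ensemble_reachable_iff_dense:
  assumes "linear G" "linear B"
  shows "dt_ensemble_reachable G B \<longleftrightarrow> closure (krylov_space G B) = UNIV"
proof -
  have "dt_ensemble_reachable G B \<longleftrightarrow> closure {dt_solution G B u T |u T. True} = UNIV"
    unfolding dt_ensemble_reachable_def max_norm_approximable_iff_dense[symmetric] by blast
  then show ?thesis by (simp only: dt_reachable_set[OF assms])
qed

lemma ensemble_reachable_feedback_iff:
  fixes G :: "('x::{banach, second_countable_topology}) ^ 'n \<Rightarrow> 'x ^ 'n"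
  assumes G: "bounded_linear G" and B: "bounded_linear B" and F: "bounded_linear F"
  shows "ct_ensemble_reachable G B \<longleftrightarrow> ct_ensemble_reachable (\<lambda>x. G x + B (F x)) B"
    and "dt_ensemble_reachable G B \<longleftrightarrow> dt_ensemble_reachable (\<lambda>x. G x + B (F x)) B"
proof -
  have H: "bounded_linear (\<lambda>x. G x + B (F x))"
    by (rule bounded_linear_add[OF G bounded_linear_compose[OF B F]])
  note lin = G[THEN bounded_linear.linear] B[THEN bounded_linear.linear]
    F[THEN bounded_linear.linear] H[THEN bounded_linear.linear]
  note krylov = krylov_space_feedback[OF lin(1-3)]
  show "ct_ensemble_reachable G B \<longleftrightarrow> ct_ensemble_reachable (\<lambda>x. G x + B (F x)) B"
    by (simp only: ct_ensemble_reachable_iff_dense[OF G B] ct_ensemble_reachable_iff_dense[OF H B]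
        krylov)
  show "dt_ensemble_reachable G B \<longleftrightarrow> dt_ensemble_reachable (\<lambda>x. G x + B (F x)) B"
    by (simp only: dt_ensemble_reachable_iff_dense[OF lin(1,2)]
        dt_ensemble_reachable_iff_dense[OF lin(4,2)] krylov)
qed

section \<open>Complex-linear operators as real-linear ones\<close>

lemma bounded_linear_of_bounded_linear_op:
  assumes F: "bounded_linear_op s1 N1 s2 norm F"
    and s1: "\<And>r x. s1 (complex_of_real r) x = r *\<^sub>R x"
    and s2: "\<And>r y. s2 (complex_of_real r) y = r *\<^sub>R y"
    and N1: "\<And>x. 0 \<le> N1 x" "\<And>x. N1 x \<le> norm x"
  shows "bounded_linear F"
proof -
  obtain K where lin: "Vector_Spaces.linear s1 s2 F" and K: "\<And>x. norm (F x) \<le> K * N1 x"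
    using F unfolding bounded_linear_op_def by blast
  show ?thesis
  proof (rule bounded_linear_intro)
    show "F (x + y) = F x + F y" for x y
      using lin by (simp add: Vector_Spaces.linear_iff)
    show "F (r *\<^sub>R x) = r *\<^sub>R F x" for r x
    proof -
      have "F (s1 (complex_of_real r) x) = s2 (complex_of_real r) (F x)"
        using lin by (simp add: Vector_Spaces.linear_iff)
      then show ?thesis by (simp only: s1 s2)
    qed
    show "norm (F x) \<le> norm x * \<bar>K\<bar>" for x
    proof -
      have "K * N1 x \<le> \<bar>K\<bar> * norm x"
        using N1[of x] by (intro mult_mono) auto
      with K[of x] show ?thesis by (simp add: mult.commute)
    qed
  qed
qed

lemma bounded_linear_op_max_norm_imp_norm:
  assumes "bounded_linear_op s1 N1 s2 max_norm (F :: _ \<Rightarrow> ('x::real_normed_vector) ^ 'n)"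
  shows "bounded_linear_op s1 N1 s2 norm F"
proof -
  obtain K where K: "\<And>x. max_norm (F x) \<le> K * N1 x"
    using assms unfolding bounded_linear_op_def by blast
  have "norm (F x) \<le> real CARD('n) * K * N1 x" for x
    unfolding mult.assoc
    by (rule order_trans[OF norm_le_card_max_norm mult_left_mono[OF K of_nat_0_le_iff]])
  then show ?thesis
    using assms unfolding bounded_linear_op_def by blast
qed

context banach_function_space
begin

lemma vec_smul_of_real: "vec_smul smul (complex_of_real r) x = r *\<^sub>R x"
  by (simp add: vec_smul_def smul_of_real vec_eq_iff)

lemma smul_add_left: "smul (a + b) x = smul a x + smul b x"
  by (rule ev_inject) (simp add: ev_add ev_smul distrib_right)

lemma smul_scaleR_left: "smul (r *\<^sub>R a) x = r *\<^sub>R smul a x"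
  unfolding smul_of_real[symmetric]
  by (rule ev_inject) (simp add: ev_smul scaleR_conv_of_real)

lemma bounded_linear_input_op: "bounded_linear (input_op P ev B)"
  unfolding linear_conv_bounded_linear[symmetric]
  by (rule linearI)
    (simp_all add: input_op_eq vec_eq_iff smul_add_left smul_scaleR_left sum.distrib
      scaleR_sum_right)

end

theorem theorem3p1:
  fixes P :: "complex set"
    and ev :: "'x::{banach, second_countable_topology} \<Rightarrow> complex \<Rightarrow> complex"
    and smul :: "complex \<Rightarrow> 'x \<Rightarrow> 'x"
    and A :: "complex \<Rightarrow> complex^'n^'n"
    and B :: "'x^'m^'n"
    and F :: "'x^'n \<Rightarrow> complex^'m"
  assumes "compact P" and "P \<noteq> {}"
    and "banach_function_space P ev smul"
    and "\<And>M :: complex \<Rightarrow> complex^'n^'n. continuous_matrix P M \<Longrightarrow>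
           (\<forall>f. \<exists>g. represents P ev g (\<lambda>\<theta>. M \<theta> *v vec_ev ev f \<theta>)) \<and>
           bounded_linear_op (vec_smul smul) max_norm (vec_smul smul) max_norm (mult_op P ev M)"
    and "continuous_matrix P A"
    and "bounded_linear_op (vec_smul smul) max_norm (*s) norm F"
  shows "(ct_ensemble_reachable (mult_op P ev A) (input_op P ev B) \<longleftrightarrow>
          ct_ensemble_reachable (\<lambda>x. mult_op P ev A x + input_op P ev B (F x)) (input_op P ev B)) \<and>
         (dt_ensemble_reachable (mult_op P ev A) (input_op P ev B) \<longleftrightarrow>
          dt_ensemble_reachable (\<lambda>x. mult_op P ev A x + input_op P ev B (F x)) (input_op P ev B))"
proof -
  interpret banach_function_space P ev smul by (rule assms(3))
  have cscale: "complex_of_real r *s y = r *\<^sub>R y" for r and y :: "complex^'m"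
    by (simp add: vec_eq_iff scaleR_conv_of_real[where 'a = complex])
  have "bounded_linear_op (vec_smul smul) max_norm (vec_smul smul) norm (mult_op P ev A)"
    by (rule bounded_linear_op_max_norm_imp_norm) (use assms(4)[OF assms(5)] in blast)
  then have G: "bounded_linear (mult_op P ev A)"
    by (rule bounded_linear_of_bounded_linear_op)
      (simp_all add: vec_smul_of_real max_norm_nonneg max_norm_le_norm)
  have F: "bounded_linear F"
    by (rule bounded_linear_of_bounded_linear_op[OF assms(6)])
      (simp_all add: vec_smul_of_real cscale max_norm_nonneg max_norm_le_norm)
  show ?thesis
    using ensemble_reachable_feedback_iff[OF G bounded_linear_input_op F] by blast
qed

end
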